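(* Let $\mathcal{V}$ be an $\alpha$-valuation of the complete bipartite graph $K_{a,b}$ with $ab>1$. Then there exists an integer $\ell>1$ such that $\mathcal{V}$ is equivalent to an $\alpha$-valuation $(V^{\sf small},V^{\sf large})$ with the following properties: (1) every element of $V^{\sf small}$ is a multiple of $\ell$; (2) the set $V^{\sf large}$ is a union of runs of $\ell$ consecutive integers each of which ends with a multiple of $\ell$ (i.e., of sets $\{i\ell-\ell+1,\dots,i\ell-1,i\ell\}$).
   Context: For a graph $G$ with $n$ edges, an $\alpha$-valuation is a one-to-one map from the vertices into $\{0,1,\dots,n\}$ such that the absolute differences of the labels of the endpoints of the edges are exactly $\{1,\dots,n\}$, and there is a value $x$ with $0\le x\le n$ such that every edge joins a vertex with label $\le x$ to one with label $>x$. Vertices are identified with labels; $V^{\sf small}$ is the set of labels $\le x$ and $V^{\sf large}$ the set of labels $>x$. For $K_{a,b}$ the labels lie in $\{0,\dots,ab\}$. Define $\Phi_{ab}(z)=ab-z$ on $\{0,\dots,ab\}$. Two $\alpha$-valuations $\mathcal{V}_1,\mathcal{V}_2$ of $K_{a,b}$ are equivalent if $\mathcal{V}_1=\mathcal{V}_2$, or if for every vertex its label in $\mathcal{V}_2$ is obtained by applying $\Phi_{ab}$ to its label in $\mathcal{V}_1$. *)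

theory Defs
  imports Main
begin

text \<open>A graph is given by its vertex set \<open>V\<close> and its set \<open>E\<close> of two-element vertex sets.\<close>

definition complete_bipartite :: "nat \<Rightarrow> nat \<Rightarrow> 'v set \<Rightarrow> 'v set set \<Rightarrow> bool" where
  "complete_bipartite a b V E \<longleftrightarrow>
     (\<exists>A B. finite A \<and> finite B \<and> card A = a \<and> card B = b \<and> A \<inter> B = {} \<and>
        V = A \<union> B \<and> E = {{u, v} | u v. u \<in> A \<and> v \<in> B})"

text \<open>The value \<open>x\<close> of an alpha-valuation is a parameter here because \<open>small_labels\<close> and
  \<open>large_labels\<close> refer to it. If \<open>E\<close> is finite and nonempty it is determined by \<open>f\<close>: it is the
  smaller label on the edge whose label difference is 1.\<close>

definition alpha_valuation_at :: "'v set \<Rightarrow> 'v set set \<Rightarrow> ('v \<Rightarrow> int) \<Rightarrow> int \<Rightarrow> bool" where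
  "alpha_valuation_at V E f x \<longleftrightarrow>
     inj_on f V \<and>
     f ` V \<subseteq> {0..int (card E)} \<and>
     {\<bar>f u - f v\<bar> | u v. {u, v} \<in> E} = {1..int (card E)} \<and>
     0 \<le> x \<and> x \<le> int (card E) \<and>
     (\<forall>e\<in>E. \<exists>u v. e = {u, v} \<and> f u \<le> x \<and> x < f v)"

definition alpha_valuation :: "'v set \<Rightarrow> 'v set set \<Rightarrow> ('v \<Rightarrow> int) \<Rightarrow> bool" where
  "alpha_valuation V E f \<longleftrightarrow> (\<exists>x. alpha_valuation_at V E f x)"

definition small_labels :: "'v set \<Rightarrow> ('v \<Rightarrow> int) \<Rightarrow> int \<Rightarrow> int set" where
  "small_labels V f x = {z \<in> f ` V. z \<le> x}"

definition large_labels :: "'v set \<Rightarrow> ('v \<Rightarrow> int) \<Rightarrow> int \<Rightarrow> int set" where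
  "large_labels V f x = {z \<in> f ` V. x < z}"

definition Phi :: "nat \<Rightarrow> int \<Rightarrow> int" where
  "Phi n z = int n - z"

text \<open>Valuations are compared on \<open>V\<close> only; their values elsewhere are irrelevant.\<close>

definition equivalent_valuations ::
    "nat \<Rightarrow> nat \<Rightarrow> 'v set \<Rightarrow> ('v \<Rightarrow> int) \<Rightarrow> ('v \<Rightarrow> int) \<Rightarrow> bool" where
  "equivalent_valuations a b V f g \<longleftrightarrow>
     (\<forall>v\<in>V. f v = g v) \<or> (\<forall>v\<in>V. g v = Phi (a * b) (f v))"

end

theory Submission
  imports Defs
begin

text \<open>Let \<open>S\<close> and \<open>L\<close> be the sets of small and large labels. If \<open>x\<close> is the largest small label,
  then \<open>P = {x - s | s. s \<in> S}\<close> and \<open>Q = {t - (x + 1) | t. t \<in> L}\<close> form a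
  direct-sum decomposition of the interval \<open>{0..<a * b}\<close>. Exactly one of \<open>P\<close>, \<open>Q\<close> contains 1, and
  \<open>Phi\<close> exchanges them, so let \<open>1 \<in> Q\<close>. As in de Bruijn's theorem on such decompositions, take
  \<open>l\<close> to be the least positive element of \<open>P\<close>, or \<open>a * b\<close> if there is none; induction on the
  blocks \<open>{k * l..<k * l + l}\<close> shows that \<open>P\<close> meets each block at most in its first element and
  that \<open>Q\<close> contains all or nothing of each block.\<close>

section \<open>Decompositions of an interval into sums and differences of two sets\<close>

lemma interval_decomposition_blocks:
  fixes P Q :: "nat set" and n l :: nat
  assumes inj: "\<And>p q p' q'. p \<in> P \<Longrightarrow> q \<in> Q \<Longrightarrow> p' \<in> P \<Longrightarrow> q' \<in> Q \<Longrightarrow> p + q = p' + q' \<Longrightarrow> p = p' \<and> q = q'"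
    and bound: "\<And>p q. p \<in> P \<Longrightarrow> q \<in> Q \<Longrightarrow> p + q < n"
    and surj: "\<And>m. m < n \<Longrightarrow> \<exists>p\<in>P. \<exists>q\<in>Q. m = p + q"
    and l: "l \<in> P" "l > 0" "\<And>p. p \<in> P \<Longrightarrow> p > 0 \<Longrightarrow> l \<le> p"
    and zero: "0 \<in> P" "0 \<in> Q"
  shows "j < l \<Longrightarrow> (k * l + j \<in> P \<longrightarrow> j = 0) \<and> (k * l + j \<in> Q \<longleftrightarrow> k * l \<in> Q)"
proof (induction k arbitrary: j rule: less_induct)
  case (less k)
  \<comment> \<open>Block 0 lies in \<open>Q\<close>: a representation \<open>j = p + q\<close> has
    \<open>p < l\<close>, so \<open>p = 0\<close> by minimality of \<open>l\<close>.\<close>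
  have first: "j \<in> Q" if "j < l" for j
  proof -
    have "j < n" using that bound[OF l(1) zero(2)] by simp
    then obtain p q where pq: "p \<in> P" "q \<in> Q" "j = p + q" using surj by blast
    then have "p = 0" using l(3)[of p] that by fastforce
    then show ?thesis using pq by simp
  qed
  have P_lt: "l dvd m" if "m < k * l" "m \<in> P" for m
  proof -
    have "m div l < k" using that(1) by (simp add: less_mult_imp_div_less)
    then have "m mod l = 0" using less.IH[of "m div l" "m mod l"] that(2) l(2) by simp
    then show ?thesis by auto
  qed
  have Q_lt: "m + i \<in> Q \<longleftrightarrow> m \<in> Q" if "m < k * l" "l dvd m" "i < l" for m i
  proof -
    from that(2) obtain c where c: "m = c * l" by (metis dvd_def mult.commute)
    then have "c < k" using that(1) by simp
    then show ?thesis using less.IH[OF _ that(3)] c by blast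
  qed
  show ?case
  proof (cases "k = 0")
    case True
    have "j = 0" if "j \<in> P" using inj[OF that zero(2) zero(1) first[OF less.prems]] by simp
    then show ?thesis using True first[OF less.prems] zero by simp
  next
    case False
    then have kl: "k * l \<ge> l" "k * l > 0" using l(2) by auto
    show ?thesis
    proof (cases "k * l < n")
      \<comment> \<open>Since 0 lies in both sets, \<open>P\<close> and \<open>Q\<close> stay below
        \<open>n\<close>, so this block misses both.\<close>
      case False
      then show ?thesis using bound[OF _ zero(2), of "k * l + j"] bound[OF zero(1), of "k * l + j"]
          bound[OF zero(1), of "k * l"] by fastforce
    next
      case True
      then obtain p q where pq: "p \<in> P" "q \<in> Q" "k * l = p + q" using surj by blast
      show ?thesis
      proof (cases "p = 0")
        case False
        \<comment> \<open>Both \<open>p\<close> and \<open>q\<close> turn out to be multiples of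
          \<open>l\<close>, and translation by \<open>p\<close> carries the block of
          \<open>Q\<close> starting at \<open>q\<close> onto block \<open>k\<close>. Uniqueness then
          keeps block \<open>k\<close> out of \<open>Q\<close>, and out of \<open>P\<close> except
          possibly for its first element.\<close>
        have dp: "l dvd p"
        proof (cases "q = 0")
          case True then show ?thesis using pq(3) by (metis add_0_right dvd_triv_right)
        next
          case False then show ?thesis using pq P_lt[of p] by simp
        qed
        then have dq: "l dvd q" using pq(3) by (metis dvd_add_right_iff dvd_triv_right)
        have qj: "q + i \<in> Q" if "i < l" for i using Q_lt[of q i] pq dq False that by simp
        have "k * l + i \<notin> Q" if "i < l" for i
          using inj[OF zero(1) _ pq(1) qj[OF that], of "k * l + i"] pq(3) False by auto
        moreover have "j = 0" if "k * l + j \<in> P"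
          using inj[OF that zero(2) pq(1) qj[OF less.prems]] pq(3) by simp
        ultimately show ?thesis using less.prems l(2) by (metis add_0_right)
      next
        case True
        then have klQ: "k * l \<in> Q" using pq by simp
        \<comment> \<open>An element \<open>k * l + i\<close> of \<open>P\<close> would yield two
          representations of one number: of \<open>k * l\<close> if \<open>i = 0\<close>, and
          otherwise of \<open>(k * l + i) + (l - i) = l + k * l\<close>, where \<open>l - i\<close>
          comes from block 0.\<close>
        have noP: "k * l + i \<notin> P" if i: "i < l" for i
        proof
          assume h: "k * l + i \<in> P"
          show False
          proof (cases "i = 0")
            case True
            then show False using inj[OF h zero(2) zero(1) klQ] kl by simp
          next
            case False
            then have "l - i \<in> Q" using first l(2) by simp
            then show False using inj[OF h _ l(1) klQ, of "l - i"] i kl False by simp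
          qed
        qed
        have "k * l + j < n" using bound[OF l(1) klQ] less.prems by simp
        then obtain p' q' where pq': "p' \<in> P" "q' \<in> Q" "k * l + j = p' + q'" using surj by blast
        \<comment> \<open>A positive \<open>p'\<close> would lie below \<open>k * l\<close> by
          \<open>noP\<close>, hence be a multiple of \<open>l\<close>. Then \<open>q'\<close> lies
          in the earlier block starting at \<open>k * l - p'\<close>, so that start is in
          \<open>Q\<close> too, and \<open>k * l = p' + (k * l - p')\<close> contradicts
          uniqueness.\<close>
        have "p' = 0"
        proof (rule ccontr)
          assume p0: "p' \<noteq> 0"
          have lt: "p' < k * l"
          proof (rule ccontr)
            assume "\<not> p' < k * l"
            then obtain i where "p' = k * l + i" by (metis le_Suc_ex not_less)
            then show False using noP[of i] pq' less.prems by simp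
          qed
          have d: "l dvd p'" using P_lt lt pq'(1) by blast
          have "l dvd k * l - p'" using d by simp
          moreover have "k * l - p' + j = q'" using pq'(3) lt by simp
          ultimately have "k * l - p' \<in> Q" using Q_lt[of "k * l - p'" j] pq'(2) less.prems p0 lt by auto
          then show False using inj[OF pq'(1) _ zero(1) klQ, of "k * l - p'"] lt p0 by simp
        qed
        then have "k * l + j \<in> Q" using pq' by simp
        then show ?thesis using klQ noP less.prems by blast
      qed
    qed
  qed
qed

lemma interval_decomposition_period:
  fixes P Q :: "nat set" and n :: nat
  assumes inj: "\<And>p q p' q'. p \<in> P \<Longrightarrow> q \<in> Q \<Longrightarrow> p' \<in> P \<Longrightarrow> q' \<in> Q \<Longrightarrow> p + q = p' + q' \<Longrightarrow> p = p' \<and> q = q'"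
    and bound: "\<And>p q. p \<in> P \<Longrightarrow> q \<in> Q \<Longrightarrow> p + q < n"
    and surj: "\<And>m. m < n \<Longrightarrow> \<exists>p\<in>P. \<exists>q\<in>Q. m = p + q"
    and zero: "0 \<in> P" "0 \<in> Q" and one: "1 \<in> Q"
  shows "\<exists>l>1. (\<forall>p\<in>P. l dvd p) \<and> (\<exists>K. Q = (\<Union>k\<in>K. {k * l..<k * l + l}))"
proof (cases "\<exists>p. p \<in> P \<and> p > 0")
  case False
  then have P: "P = {0}" using zero by auto
  \<comment> \<open>With \<open>P\<close> trivial, \<open>Q\<close> is the whole interval: a single
    block, with \<open>n\<close> itself as the period.\<close>
  have "Q = {0..<n}" using bound[OF zero(1)] surj by (fastforce simp: P)
  then have "Q = (\<Union>k\<in>{0}. {k * n..<k * n + n})" by simp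
  moreover have "n > 1" using bound[OF zero(1) one] by simp
  ultimately show ?thesis using P by (intro exI[of _ n]) blast
next
  case True
  define l where "l = (LEAST p. p \<in> P \<and> p > 0)"
  have l: "l \<in> P" "l > 0" using LeastI_ex[OF True] by (auto simp: l_def)
  have lmin: "l \<le> p" if "p \<in> P" "p > 0" for p using that by (auto simp: l_def intro: Least_le)
  have blocks: "(k * l + j \<in> P \<longrightarrow> j = 0) \<and> (k * l + j \<in> Q \<longleftrightarrow> k * l \<in> Q)"
    if "j < l" for j k
    by (rule interval_decomposition_blocks[of P Q n]) (use inj bound surj l lmin zero that in blast)+
  \<comment> \<open>Otherwise 1 would lie in both sets, and \<open>1 + 0 = 0 + 1\<close> violates
    uniqueness.\<close>
  have "l \<noteq> 1" using inj[OF l(1) zero(2) zero(1) one] by auto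
  then have "l > 1" using l(2) by simp
  moreover have "l dvd p" if "p \<in> P" for p
  proof -
    have "p div l * l + p mod l \<in> P" using that by simp
    then have "p mod l = 0"
      using blocks[of "p mod l" "p div l"] mod_less_divisor[OF l(2)] by blast
    then show ?thesis by auto
  qed
  moreover have "Q = (\<Union>k\<in>{k. k * l \<in> Q}. {k * l..<k * l + l})"
  proof (intro equalityI subsetI)
    fix q assume "q \<in> Q"
    then have "q div l * l + q mod l \<in> Q" by simp
    then have "q div l * l \<in> Q"
      using blocks[of "q mod l" "q div l"] mod_less_divisor[OF l(2)] by blast
    moreover have "q \<in> {q div l * l..<q div l * l + l}"
      using div_mult_mod_eq[of q l] mod_less_divisor[OF l(2), of q]
      by (simp only: atLeastLessThan_iff) linarith
    ultimately show "q \<in> (\<Union>k\<in>{k. k * l \<in> Q}. {k * l..<k * l + l})" by blast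
  next
    fix q assume "q \<in> (\<Union>k\<in>{k. k * l \<in> Q}. {k * l..<k * l + l})"
    then obtain k where k: "k * l \<in> Q" "k * l \<le> q" "q < k * l + l" by auto
    then have "q - k * l < l" "k * l + (q - k * l) = q" by linarith+
    then show "q \<in> Q" using blocks[of "q - k * l" k] k(1) by metis
  qed
  ultimately show ?thesis by (intro exI[of _ l]) blast
qed

text \<open>With \<open>p = x - s\<close> and \<open>q = t - (x + 1)\<close>, the difference
  \<open>t - s\<close> equals \<open>p + q + 1\<close>, so the differences 1 to \<open>n\<close>
  become the sums 0 to \<open>n - 1\<close>. In \<open>mem\<close>, the labels \<open>x\<close> and
  \<open>x + 1\<close> put 0 into both sets, and \<open>x + 2\<close> puts 1 into
  \<open>Q\<close>.\<close>

lemma difference_decomposition_period: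
  fixes S L :: "int set" and x n :: int
  assumes inj: "\<And>s t s' t'. s \<in> S \<Longrightarrow> t \<in> L \<Longrightarrow> s' \<in> S \<Longrightarrow> t' \<in> L \<Longrightarrow> t - s = t' - s' \<Longrightarrow> s = s' \<and> t = t'"
    and bound: "\<And>s t. s \<in> S \<Longrightarrow> t \<in> L \<Longrightarrow> t - s \<le> n"
    and surj: "\<And>d. 1 \<le> d \<Longrightarrow> d \<le> n \<Longrightarrow> \<exists>s\<in>S. \<exists>t\<in>L. d = t - s"
    and le: "\<And>s. s \<in> S \<Longrightarrow> s \<le> x" and gt: "\<And>t. t \<in> L \<Longrightarrow> x < t"
    and mem: "0 \<in> S" "x \<in> S" "x + 1 \<in> L" "x + 2 \<in> L"
  shows "\<exists>l>1. (\<forall>s\<in>S. l dvd s) \<and> (\<exists>I. L = (\<Union>i\<in>I. {i * l - l + 1..i * l}))"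
proof -
  define P where "P = {p::nat. x - int p \<in> S}"
  define Q where "Q = {q::nat. x + 1 + int q \<in> L}"
  have "\<exists>l>1. (\<forall>p\<in>P. l dvd p) \<and> (\<exists>K. Q = (\<Union>k\<in>K. {k * l..<k * l + l}))"
  proof (rule interval_decomposition_period[of P Q "nat n"])
    fix p q p' q' assume "p \<in> P" "q \<in> Q" "p' \<in> P" "q' \<in> Q" "p + q = p' + q'"
    then show "p = p' \<and> q = q'"
      using inj[of "x - int p" "x + 1 + int q" "x - int p'" "x + 1 + int q'"]
      by (simp add: P_def Q_def)
  next
    fix p q assume "p \<in> P" "q \<in> Q"
    then show "p + q < nat n" using bound[of "x - int p" "x + 1 + int q"] by (simp add: P_def Q_def)
  next
    fix m assume "m < nat n"
    then have "1 \<le> int m + 1" "int m + 1 \<le> n" by linarith+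
    then obtain s t where st: "s \<in> S" "t \<in> L" "int m + 1 = t - s" using surj by blast
    have "nat (x - s) \<in> P" "nat (t - x - 1) \<in> Q"
      using st le[of s] gt[of t] by (auto simp: P_def Q_def)
    moreover have "m = nat (x - s) + nat (t - x - 1)" using st le[of s] gt[of t] by auto
    ultimately show "\<exists>p\<in>P. \<exists>q\<in>Q. m = p + q" by blast
  qed (use mem in \<open>auto simp: P_def Q_def add.assoc\<close>)
  then obtain l K where l: "l > 1" "\<And>p. p \<in> P \<Longrightarrow> l dvd p" and K: "Q = (\<Union>k\<in>K. {k * l..<k * l + l})"
    by blast
  have dP: "int l dvd x - s" if "s \<in> S" for s
  proof -
    have "nat (x - s) \<in> P" using that le[of s] by (simp add: P_def)
    from l(2)[OF this] show ?thesis using le[OF that] by (simp add: int_dvd_int_iff[symmetric])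
  qed
  \<comment> \<open>The label 0 corresponds to \<open>x\<close> in \<open>P\<close>. This aligns the
    blocks, so far measured from \<open>x\<close>, with the multiples of \<open>l\<close>.\<close>
  have dx: "int l dvd x" using dP[OF mem(1)] by simp
  then obtain c where c: "x = c * int l" by (metis dvd_def mult.commute)
  have "int l dvd s" if "s \<in> S" for s using dP[OF that] dx by (metis dvd_diff_right_iff)
  \<comment> \<open>Shifting block \<open>k\<close> of \<open>Q\<close> by
    \<open>x + 1 = c * l + 1\<close> gives the run from \<open>(c + k) * l + 1\<close> to
    \<open>(c + k + 1) * l\<close>; runs are indexed by their last element.\<close>
  moreover have "L = (\<Union>i\<in>(\<lambda>k. c + int k + 1) ` K. {i * int l - int l + 1..i * int l})"
  proof (intro equalityI subsetI)
    fix t assume t: "t \<in> L"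
    then have "nat (t - x - 1) \<in> Q" using gt[of t] by (simp add: Q_def)
    then obtain k where k: "k \<in> K" "k * l \<le> nat (t - x - 1)" "nat (t - x - 1) < k * l + l"
      using K by auto
    then have "int (k * l) \<le> t - x - 1" "t - x - 1 < int (k * l + l)" using gt[OF t] by linarith+
    then have "t \<in> {(c + int k + 1) * int l - int l + 1..(c + int k + 1) * int l}"
      by (simp add: c algebra_simps)
    then show "t \<in> (\<Union>i\<in>(\<lambda>k. c + int k + 1) ` K. {i * int l - int l + 1..i * int l})"
      using k(1) by blast
  next
    fix t assume "t \<in> (\<Union>i\<in>(\<lambda>k. c + int k + 1) ` K. {i * int l - int l + 1..i * int l})"
    then obtain k where k: "k \<in> K"
      "t \<in> {(c + int k + 1) * int l - int l + 1..(c + int k + 1) * int l}" by blast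
    then have b: "int (k * l) \<le> t - x - 1" "t - x - 1 < int (k * l + l)"
      by (auto simp: c algebra_simps)
    then have nn: "0 \<le> t - x - 1" using of_nat_0_le_iff[of "k * l", where 'a = int] by linarith
    have "nat (t - x - 1) \<in> {k * l..<k * l + l}" using b nn by (simp only: atLeastLessThan_iff) linarith
    then have "nat (t - x - 1) \<in> Q" using k(1) K by blast
    then show "t \<in> L" using nn by (simp add: Q_def)
  qed
  moreover have "int l > 1" using l(1) by simp
  ultimately show ?thesis by (intro exI[of _ "int l"]) blast
qed

section \<open>Labels on the two sides of a complete bipartite graph\<close>

lemma complete_bipartite_card_edges:
  assumes "complete_bipartite a b V E"
  shows "card E = a * b"
proof -
  from assms obtain A B where AB: "finite A" "finite B" "card A = a" "card B = b" "A \<inter> B = {}"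
    "E = {{u, v} | u v. u \<in> A \<and> v \<in> B}" by (auto simp: complete_bipartite_def)
  have "E = (\<lambda>(u, v). {u, v}) ` (A \<times> B)" using AB(6) by auto
  moreover have "inj_on (\<lambda>(u, v). {u, v}) (A \<times> B)"
    using AB(5) by (auto simp: inj_on_def doubleton_eq_iff)
  ultimately have "card E = card (A \<times> B)" by (simp add: card_image)
  then show ?thesis using AB by (simp add: card_cartesian_product)
qed

lemma alpha_valuation_at_edge:
  assumes "alpha_valuation_at V E f x" "e \<in> E"
  shows "\<exists>u v. e = {u, v} \<and> f u \<le> x \<and> x < f v"
  using assms by (simp add: alpha_valuation_at_def)

text \<open>Reflection reverses the order. With \<open>n = card E\<close>, labels from
  \<open>x + 1\<close> on go to at most \<open>n - 1 - x\<close>, and labels up to \<open>x\<close>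
  go to at least \<open>n - x\<close>; this dictates the new threshold, which \<open>x < n\<close>
  keeps nonnegative.\<close>

lemma alpha_valuation_at_Phi:
  assumes "alpha_valuation_at V E f x" "x < int (card E)"
  shows "alpha_valuation_at V E (\<lambda>v. Phi (card E) (f v)) (int (card E) - 1 - x)"
proof -
  have "\<exists>u v. e = {u, v} \<and> Phi (card E) (f u) \<le> int (card E) - 1 - x \<and>
      int (card E) - 1 - x < Phi (card E) (f v)" if e: "e \<in> E" for e
  proof -
    obtain u v where "e = {u, v}" "f u \<le> x" "x < f v"
      using alpha_valuation_at_edge[OF assms(1) e] by blast
    then show ?thesis by (intro exI[of _ v] exI[of _ u]) (auto simp: Phi_def)
  qed
  moreover have "\<bar>Phi (card E) (f u) - Phi (card E) (f v)\<bar> = \<bar>f u - f v\<bar>" for u v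
    by (simp add: Phi_def abs_minus_commute)
  moreover have "inj_on (\<lambda>v. Phi (card E) (f v)) V"
    using assms(1) by (auto simp: alpha_valuation_at_def inj_on_def Phi_def)
  moreover have "(\<lambda>v. Phi (card E) (f v)) ` V \<subseteq> {0..int (card E)}"
    using assms(1) by (fastforce simp: alpha_valuation_at_def Phi_def)
  ultimately show ?thesis using assms unfolding alpha_valuation_at_def by simp
qed

text \<open>Every edge crosses the threshold, so the position of one vertex fixes the whole opposite
  side, and then its own side. The two sides may have to be swapped, hence only the product of the
  cardinalities is recorded.\<close>

lemma complete_bipartite_small_large_parts:
  assumes "complete_bipartite a b V E" "a * b > 0" "alpha_valuation_at V E f x"
  obtains A B where "finite A" "finite B" "card A * card B = a * b" "V = A \<union> B"
    "E = {{u, v} | u v. u \<in> A \<and> v \<in> B}" "\<forall>u\<in>A. f u \<le> x" "\<forall>v\<in>B. x < f v"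
proof -
  from assms(1) obtain A B where AB: "finite A" "finite B" "card A = a" "card B = b"
    "V = A \<union> B" "E = {{u, v} | u v. u \<in> A \<and> v \<in> B}" by (auto simp: complete_bipartite_def)
  have edge: "(f u \<le> x \<and> x < f v) \<or> (f v \<le> x \<and> x < f u)" if "u \<in> A" "v \<in> B" for u v
  proof -
    have "{u, v} \<in> E" using AB(6) that by blast
    then obtain u' v' where "{u, v} = {u', v'}" "f u' \<le> x" "x < f v'"
      using alpha_valuation_at_edge[OF assms(3)] by blast
    then show ?thesis by (auto simp: doubleton_eq_iff)
  qed
  have "A \<noteq> {}" "B \<noteq> {}" using AB assms(2) by auto
  then obtain u0 v0 where uv: "u0 \<in> A" "v0 \<in> B" by blast
  show thesis
  proof (cases "f u0 \<le> x")
    case True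
    then have "x < f v" if "v \<in> B" for v using edge[OF uv(1) that] by linarith
    moreover from this have "f u \<le> x" if "u \<in> A" for u using edge[OF that uv(2)] uv(2) by fastforce
    ultimately show thesis using AB that[of A B] by blast
  next
    case False
    then have "f v \<le> x" if "v \<in> B" for v using edge[OF uv(1) that] by linarith
    moreover from this have "x < f u" if "u \<in> A" for u using edge[OF that uv(2)] uv(2) by fastforce
    moreover have "E = {{u, v} | u v. u \<in> B \<and> v \<in> A}" using AB(6) by (auto simp: insert_commute)
    moreover have "card B * card A = a * b" "V = B \<union> A" using AB by auto
    ultimately show thesis using AB(1,2) that[of B A] by blast
  qed
qed

text \<open>A counting argument: there are \<open>a * b\<close> pairs of a small and a large label,
  and their differences fill a set of \<open>a * b\<close> values, so subtraction is injective on
  the pairs.\<close>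

lemma complete_bipartite_label_differences:
  assumes "complete_bipartite a b V E" "a * b > 0" "alpha_valuation_at V E f x"
  shows "\<And>s t s' t'. s \<in> small_labels V f x \<Longrightarrow> t \<in> large_labels V f x \<Longrightarrow>
      s' \<in> small_labels V f x \<Longrightarrow> t' \<in> large_labels V f x \<Longrightarrow> t - s = t' - s' \<Longrightarrow> s = s' \<and> t = t'"
    and "\<And>d. 1 \<le> d \<Longrightarrow> d \<le> int (a * b) \<Longrightarrow>
      \<exists>s\<in>small_labels V f x. \<exists>t\<in>large_labels V f x. d = t - s"
proof -
  obtain A B where AB: "finite A" "finite B" "card A * card B = a * b" "V = A \<union> B"
    "E = {{u, v} | u v. u \<in> A \<and> v \<in> B}" "\<forall>u\<in>A. f u \<le> x" "\<forall>v\<in>B. x < f v"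
    by (rule complete_bipartite_small_large_parts[OF assms])
  have S: "small_labels V f x = f ` A" and L: "large_labels V f x = f ` B"
    using AB(4,6,7) by (fastforce simp: small_labels_def large_labels_def)+
  have fv: "inj_on f V" "{\<bar>f u - f v\<bar> | u v. {u, v} \<in> E} = {1..int (a * b)}"
    using assms(3) complete_bipartite_card_edges[OF assms(1)] by (auto simp: alpha_valuation_at_def)
  define D where "D = (\<lambda>(s, t). t - s) ` (f ` A \<times> f ` B)"
  have "{\<bar>f u - f v\<bar> | u v. {u, v} \<in> E} = D"
  proof (intro equalityI subsetI)
    fix d assume "d \<in> {\<bar>f u - f v\<bar> | u v. {u, v} \<in> E}"
    then obtain u v where uv: "d = \<bar>f u - f v\<bar>" "{u, v} \<in> E" by blast
    from uv(2) obtain u' v' where uv': "{u, v} = {u', v'}" "u' \<in> A" "v' \<in> B" using AB(5) by blast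
    have "\<bar>f u - f v\<bar> = f v' - f u'"
      using uv'(1) bspec[OF AB(6) uv'(2)] bspec[OF AB(7) uv'(3)] by (auto simp: doubleton_eq_iff)
    then show "d \<in> D" using uv(1) uv' by (force simp: D_def)
  next
    fix d assume "d \<in> D"
    then obtain u v where uv: "u \<in> A" "v \<in> B" "d = f v - f u" by (auto simp: D_def)
    then have "d = \<bar>f u - f v\<bar>" "{u, v} \<in> E" using AB(5) bspec[OF AB(6) uv(1)] bspec[OF AB(7) uv(2)] by auto
    then show "d \<in> {\<bar>f u - f v\<bar> | u v. {u, v} \<in> E}" by blast
  qed
  then have D: "D = {1..int (a * b)}" using fv(2) by simp
  have cD: "card D = a * b" unfolding D by (simp del: of_nat_mult)
  have "card (f ` A \<times> f ` B) = a * b"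
    using fv(1) AB(3,4) by (simp add: card_cartesian_product card_image inj_on_Un)
  then have inj: "inj_on (\<lambda>(s, t). t - s) (f ` A \<times> f ` B)"
    using AB(1,2) cD by (intro eq_card_imp_inj_on) (simp_all add: D_def)
  show "s = s' \<and> t = t'" if "s \<in> small_labels V f x" "t \<in> large_labels V f x"
      "s' \<in> small_labels V f x" "t' \<in> large_labels V f x" "t - s = t' - s'" for s t s' t'
    using inj_onD[OF inj, of "(s, t)" "(s', t')"] that S L by auto
  show "\<exists>s\<in>small_labels V f x. \<exists>t\<in>large_labels V f x. d = t - s"
    if "1 \<le> d" "d \<le> int (a * b)" for d
  proof -
    have "d \<in> D" using D that by simp
    then show ?thesis unfolding D_def S L by auto
  qed
qed

text \<open>The difference 1 must be realized across the threshold, which leaves only the pair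
  \<open>x\<close>, \<open>x + 1\<close>.\<close>

lemma complete_bipartite_middle_labels:
  assumes "complete_bipartite a b V E" "a * b > 0" "alpha_valuation_at V E f x"
  shows "x \<in> small_labels V f x" "x + 1 \<in> large_labels V f x"
proof -
  have one: "(1::int) \<le> 1" "1 \<le> int (a * b)" using assms(2) by linarith+
  obtain s t where "s \<in> small_labels V f x" "t \<in> large_labels V f x" "1 = t - s"
    using complete_bipartite_label_differences(2)[OF assms, of 1] one by blast
  moreover from this have "s = x" "t = x + 1" by (auto simp: small_labels_def large_labels_def)
  ultimately show "x \<in> small_labels V f x" "x + 1 \<in> large_labels V f x" by auto
qed

lemma complete_bipartite_period:
  assumes "complete_bipartite a b V E" "a * b > 0" "alpha_valuation_at V E f x"
    and "x + 2 \<in> large_labels V f x"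
  shows "\<exists>l>1. (\<forall>z\<in>small_labels V f x. l dvd z) \<and>
    (\<exists>I. large_labels V f x = (\<Union>i\<in>I. {i * l - l + 1..i * l}))"
proof -
  note diffs = complete_bipartite_label_differences[OF assms(1-3)]
  have range: "0 \<le> z" "z \<le> int (a * b)" if "z \<in> small_labels V f x \<union> large_labels V f x" for z
  proof -
    have "z \<in> f ` V" using that by (auto simp: small_labels_def large_labels_def)
    moreover have "f ` V \<subseteq> {0..int (a * b)}"
      using assms(3) complete_bipartite_card_edges[OF assms(1)] by (simp add: alpha_valuation_at_def)
    ultimately show "0 \<le> z" "z \<le> int (a * b)" by auto
  qed
  have "1 \<le> int (a * b)" using assms(2) by linarith
  then obtain s t where st: "s \<in> small_labels V f x" "t \<in> large_labels V f x" "int (a * b) = t - s"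
    using diffs(2)[of "int (a * b)"] by blast
  \<comment> \<open>The largest difference \<open>a * b\<close> within labels from 0 to
    \<open>a * b\<close> forces the two extreme labels.\<close>
  then have "s = 0" using range(1)[of s] range(2)[of t] by simp
  then have z: "0 \<in> small_labels V f x" using st by simp
  show ?thesis
  proof (rule difference_decomposition_period[OF diffs(1) _ diffs(2) _ _ z
        complete_bipartite_middle_labels[OF assms(1-3)] assms(4)])
    show "t - s \<le> int (a * b)" if "s \<in> small_labels V f x" "t \<in> large_labels V f x" for s t
      using range(1)[of s] range(2)[of t] that by simp
  qed (auto simp: small_labels_def large_labels_def)
qed

theorem theorem2p9:
  fixes a b :: nat and V :: "'v set" and E :: "'v set set" and f :: "'v \<Rightarrow> int"
  assumes "complete_bipartite a b V E"
    and "a * b > 1"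
    and "alpha_valuation V E f"
  shows "\<exists>l::int. l > 1 \<and>
    (\<exists>g x. alpha_valuation_at V E g x \<and>
       equivalent_valuations a b V f g \<and>
       (\<forall>z\<in>small_labels V g x. l dvd z) \<and>
       (\<exists>I::int set. large_labels V g x = (\<Union>i\<in>I. {i * l - l + 1..i * l})))"
proof -
  have pos: "a * b > 0" using assms(2) by linarith
  note cE = complete_bipartite_card_edges[OF assms(1)]
  obtain x where x: "alpha_valuation_at V E f x" using assms(3) by (auto simp: alpha_valuation_def)
  have "\<exists>g y. alpha_valuation_at V E g y \<and> equivalent_valuations a b V f g \<and>
      y + 2 \<in> large_labels V g y"
  proof (cases "x + 2 \<in> large_labels V f x")
    case True
    then show ?thesis using x by (intro exI[of _ f] exI[of _ x]) (simp add: equivalent_valuations_def)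
  next
    case False
    \<comment> \<open>The difference 2 can only come from \<open>x\<close> and \<open>x + 2\<close>
      or from \<open>x - 1\<close> and \<open>x + 1\<close>. The first pair is excluded here, so
      \<open>x - 1\<close> is a label; its reflection lies exactly 2 above the reflected
      threshold.\<close>
    have "2 \<le> int (a * b)" using assms(2) by linarith
    then obtain s t where st: "s \<in> small_labels V f x" "t \<in> large_labels V f x" "2 = t - s"
      using complete_bipartite_label_differences(2)[OF assms(1) pos x, of 2] by auto
    then have "s \<le> x" "x < t" by (auto simp: small_labels_def large_labels_def)
    moreover have "t \<noteq> x + 2" using st False by blast
    ultimately have "s = x - 1" using st(3) by linarith
    then obtain u where u: "u \<in> V" "f u = x - 1" using st(1) by (auto simp: small_labels_def)
    have "x + 1 \<in> f ` V" using complete_bipartite_middle_labels(2)[OF assms(1) pos x]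
      by (simp add: large_labels_def)
    moreover have "f ` V \<subseteq> {0..int (card E)}" using x by (simp add: alpha_valuation_at_def)
    ultimately have lt: "x < int (card E)" by force
    have "int (card E) - 1 - x + 2 = Phi (card E) (f u)" using u by (simp add: Phi_def)
    then have "int (card E) - 1 - x + 2 \<in>
        large_labels V (\<lambda>v. Phi (card E) (f v)) (int (card E) - 1 - x)"
      using u(1) by (auto simp: large_labels_def)
    then show ?thesis using alpha_valuation_at_Phi[OF x lt] cE
      by (intro exI[of _ "\<lambda>v. Phi (card E) (f v)"] exI[of _ "int (card E) - 1 - x"])
        (simp add: equivalent_valuations_def)
  qed
  then obtain g y where g: "alpha_valuation_at V E g y" "equivalent_valuations a b V f g"
    "y + 2 \<in> large_labels V g y" by blast
  show ?thesis using complete_bipartite_period[OF assms(1) pos g(1,3)] g(1,2) by blast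
qed

end
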